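(* Let $m\ge1$ and $\ell\ge0$ be integers and $\sigma>0$. Then for all $x,y\in\mathbb{C}$, $$(-1)^mm!\,L_m^{(\ell)}(|x+y|^2;\sigma)(x+y)^\ell=\sum_{\substack{0\le i\le m+\ell\\0\le j\le m}}\binom{m+\ell}{i}\binom{m}{j}P^{m,\ell,\sigma}_{i,j}(y,\overline y)\,x^i\,\overline x^{\,j},$$ where $$P^{m,\ell,\sigma}_{i,j}(y,\overline y)=\begin{cases}(-1)^{m-j}(m-j)!\,L^{(\ell+j-i)}_{m-j}(|y|^2;\sigma)\,y^{\ell+j-i},&\ell+j\ge i,\\[4pt](-1)^{m+\ell-i}(m+\ell-i)!\,L^{(i-j-\ell)}_{m+\ell-i}(|y|^2;\sigma)\,\overline y^{\,i-j-\ell},&\ell+j\le i.\end{cases}$$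
   Context: For integers $k,\ell\ge0$, $L_k^{(\ell)}$ denotes the generalized Laguerre polynomial, defined by the generating function $\frac{1}{(1-t)^{\ell+1}}e^{-\frac{tx}{1-t}}=\sum_{k\ge0}t^kL_k^{(\ell)}(x)$, and $L_k^{(\ell)}(x;\sigma)=\sigma^kL_k^{(\ell)}(x/\sigma)$. *)

theory Defs
  imports Complex_Main "HOL-Computational_Algebra.Formal_Power_Series"
begin

text \<open>
  The value at \<open>x\<close> of the generalized Laguerre polynomial, as the coefficient of \<open>t^k\<close> in
  \<open>exp (- t x / (1 - t)) / (1 - t)^(l + 1)\<close>, read as a formal power series in \<open>t\<close>.
\<close>
definition laguerre :: "nat \<Rightarrow> nat \<Rightarrow> 'a::field_char_0 \<Rightarrow> 'a" where
  "laguerre k l x =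
     fps_nth (1 / (1 - fps_X) ^ (l + 1) * fps_compose (fps_exp 1) (- (fps_const x * fps_X) / (1 - fps_X))) k"

definition scaled_laguerre :: "nat \<Rightarrow> nat \<Rightarrow> 'a::field_char_0 \<Rightarrow> 'a \<Rightarrow> 'a" where
  "scaled_laguerre k l x \<sigma> = \<sigma> ^ k * laguerre k l (x / \<sigma>)"

text \<open>
  Only used for \<open>i \<le> m + l\<close> and \<open>j \<le> m\<close>; the truncated subtractions are then exact in the
  branch where they occur.
\<close>
definition laguerre_P :: "nat \<Rightarrow> nat \<Rightarrow> real \<Rightarrow> nat \<Rightarrow> nat \<Rightarrow> complex \<Rightarrow> complex" where
  "laguerre_P m l \<sigma> i j y =
     (if i \<le> l + j
      then (-1) ^ (m - j) * fact (m - j)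
             * of_real (scaled_laguerre (m - j) (l + j - i) ((cmod y)\<^sup>2) \<sigma>) * y ^ (l + j - i)
      else (-1) ^ (m + l - i) * fact (m + l - i)
             * of_real (scaled_laguerre (m + l - i) (i - j - l) ((cmod y)\<^sup>2) \<sigma>) * cnj y ^ (i - j - l))"

text \<open>The second formula also holds in the overlapping case \<open>l + j = i\<close>.\<close>
lemma laguerre_P_second_case:
  assumes "l + j \<le> i"
  shows "laguerre_P m l \<sigma> i j y =
    (-1) ^ (m + l - i) * fact (m + l - i)
      * of_real (scaled_laguerre (m + l - i) (i - j - l) ((cmod y)\<^sup>2) \<sigma>) * cnj y ^ (i - j - l)"
proof (cases "i = l + j")
  case True
  then have "m + l - i = m - j" by simp
  with True show ?thesis by (simp add: laguerre_P_def)
next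
  case False
  with assms show ?thesis by (simp add: laguerre_P_def)
qed

end

theory Submission imports Defs begin

text \<open>
  Let \<open>H\<^sub>p\<^sub>q(a, b) = \<Sum>k. k! (p choose k) (q choose k) (-\<sigma>)^k a^(p-k) b^(q-k)\<close> be the two-variable
  (complex) Hermite polynomial. It is the result of applying \<open>exp (-\<sigma> \<partial>\<^sub>a \<partial>\<^sub>b)\<close> to
  \<open>a^p b^q\<close>. This operator commutes with translations, so the binomial expansion of
  \<open>(z + a)^p (w + b)^q\<close> in powers of \<open>z\<close> and \<open>w\<close> carries over: \<open>H\<^sub>p\<^sub>q(z + a, w + b)\<close> is the sum
  of \<open>(p choose i) (q choose j) H\<^sub>p\<^sub>-\<^sub>i\<^sub>,\<^sub>q\<^sub>-\<^sub>j(a, b) z^i w^j\<close>, which is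
  \<open>complex_hermite_translate\<close>.

  The explicit form of the Laguerre polynomial, extracted from its generating function in
  \<open>laguerre_explicit\<close>, gives
  \<open>H\<^sub>q\<^sub>+\<^sub>l\<^sub>,\<^sub>q(a, b) = (-1)^q q! L\<^sub>q\<^sup>(\<^sup>l\<^sup>)(a b; \<sigma>) a^l\<close> (\<open>scaled_laguerre_eq_complex_hermite\<close>).
  With \<open>b\<close> the conjugate of \<open>a\<close>, the left-hand side of the theorem is therefore
  \<open>H\<^sub>m\<^sub>+\<^sub>l\<^sub>,\<^sub>m\<close> at \<open>x + y\<close>. The coefficient \<open>P\<close> is \<open>H\<^sub>m\<^sub>+\<^sub>l\<^sub>-\<^sub>i\<^sub>,\<^sub>m\<^sub>-\<^sub>j\<close> at \<open>y\<close>: its two cases say which of the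
  two indices is the larger one, and they are exchanged by the symmetry
  \<open>H\<^sub>p\<^sub>q(a, b) = H\<^sub>q\<^sub>p(b, a)\<close>. So the theorem is the translation formula with \<open>z = x\<close> and \<open>a = y\<close>.
\<close>

section \<open>The explicit form of the Laguerre polynomials\<close>

lemma inverse_one_minus_fps_X_power_nth:
  "fps_nth (inverse ((1 - fps_X) ^ Suc n) :: 'a::field_char_0 fps) k = of_nat ((n + k) choose k)"
  using one_minus_const_fps_X_neg_power'[of "Suc n" "1::'a"] by simp

text \<open>
  The \<open>k\<close>-th term of the exponential contributes \<open>(-x)^k / k!\<close> times
  \<open>t^k / (1 - t)^(k + l + 1)\<close>, whose \<open>m\<close>-th coefficient is given by the negative binomial series.
\<close>
lemma laguerre_explicit:
  fixes x :: "'a::field_char_0"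
  shows "laguerre m l x = (\<Sum>k\<le>m. of_nat ((m + l) choose (m - k)) * (- x) ^ k / fact k)"
proof -
  define A :: "'a fps" where "A = inverse ((1 - fps_X) ^ Suc l)"
  define b :: "'a fps" where "b = - (fps_const x * fps_X) / (1 - fps_X)"
  have b_eq: "b = fps_const (- x) * fps_X * inverse (1 - fps_X)"
    unfolding b_def by (subst fps_divide_unit) (simp_all flip: fps_const_neg)
  have b0: "fps_nth b 0 = 0"
    by (simp add: b_eq)
  have A_eq: "1 / (1 - fps_X) ^ (l + 1) = A"
    unfolding A_def by (subst fps_divide_unit) simp_all
  have pow: "fps_nth (A * b ^ k) m = (- x) ^ k * of_nat ((m + l) choose (m - k))"
    if "k \<le> m" for k
  proof -
    have "A * b ^ k = fps_const ((- x) ^ k) *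
            (fps_X ^ k * inverse ((1 - fps_X) ^ Suc (k + l)))"
      by (simp add: A_def b_eq power_mult_distrib fps_inverse_mult
          fps_inverse_power power_add mult_ac)
    then have "fps_nth (A * b ^ k) m = (- x) ^ k *
        fps_nth (inverse ((1 - fps_X) ^ Suc (k + l))) (m - k)"
      using that by (simp only: fps_mult_left_const_nth fps_X_power_mult_nth) simp
    also have "\<dots> = (- x) ^ k * of_nat ((m + l) choose (m - k))"
      using that by (simp only: inverse_one_minus_fps_X_power_nth) (simp add: add.commute)
    finally show ?thesis .
  qed
  have "laguerre m l x = fps_nth (A * (fps_exp 1 oo b)) m"
    unfolding laguerre_def A_eq b_def ..
  also have "\<dots> = (\<Sum>p=0..m. \<Sum>k=0..m. fps_nth A p * (fps_nth (b ^ k) (m - p) / fact k))"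
  proof (unfold fps_mult_nth, intro sum.cong refl)
    fix p assume "p \<in> {0..m}"
    \<comment> \<open>As \<open>b\<close> has no constant term, \<open>b ^ k\<close> starts at degree \<open>k\<close>, so the inner sum may run up to
      \<open>m\<close> for every \<open>p\<close>.\<close>
    have "fps_nth (fps_exp 1 oo b) (m - p) = (\<Sum>k=0..m. fps_nth (b ^ k) (m - p) / fact k)"
      unfolding fps_compose_nth
      by (intro sum.mono_neutral_cong_left) (auto simp: startsby_zero_power_prefix[OF b0])
    then show "fps_nth A p * fps_nth (fps_exp 1 oo b) (m - p)
        = (\<Sum>k=0..m. fps_nth A p * (fps_nth (b ^ k) (m - p) / fact k))"
      by (simp add: sum_distrib_left)
  qed
  also have "\<dots> = (\<Sum>k=0..m. fps_nth (A * b ^ k) m / fact k)"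
    by (subst sum.swap) (simp add: fps_mult_nth sum_divide_distrib)
  also have "\<dots> = (\<Sum>k\<le>m. of_nat ((m + l) choose (m - k)) * (- x) ^ k / fact k)"
    by (intro sum.cong) (auto simp: pow mult.commute)
  finally show ?thesis .
qed

text \<open>
  Summing in reverse order turns \<open>\<sigma>^m (x / \<sigma>)^(m-k)\<close> into \<open>\<sigma>^k x^(m-k)\<close>, and
  \<open>m! / (m-k)!\<close> is \<open>k! (m choose k)\<close>, so the sum takes the shape of a Hermite polynomial.
\<close>
lemma scaled_laguerre_explicit:
  fixes x \<sigma> :: "'a::field_char_0"
  assumes "\<sigma> \<noteq> 0"
  shows "(-1) ^ m * fact m * scaled_laguerre m l x \<sigma> =
    (\<Sum>k\<le>m. fact k * of_nat ((m + l) choose k) * of_nat (m choose k) * (- \<sigma>) ^ k * x ^ (m - k))"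
proof -
  have "(-1) ^ m * fact m * scaled_laguerre m l x \<sigma> =
      (\<Sum>k\<le>m. (-1) ^ m * fact m * \<sigma> ^ m *
         (of_nat ((m + l) choose k) * (- (x / \<sigma>)) ^ (m - k) / fact (m - k)))"
    unfolding scaled_laguerre_def laguerre_explicit
    by (subst sum.nat_diff_reindex[symmetric, of _ "Suc m", unfolded lessThan_Suc_atMost])
       (simp add: sum_distrib_left mult.assoc)
  also have "\<dots> = (\<Sum>k\<le>m. fact k * of_nat ((m + l) choose k) * of_nat (m choose k)
      * (- \<sigma>) ^ k * x ^ (m - k))"
  proof (intro sum.cong refl)
    fix k assume "k \<in> {..m}"
    then obtain d where m: "m = k + d" by (auto simp: le_iff_add)
    have "fact m = fact k * fact d * (of_nat (m choose k) :: 'a)"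
      using binomial_fact_lemma[of k m] unfolding m
      by (metis add_diff_cancel_left' le_add1 of_nat_fact of_nat_mult)
    moreover have "(-1) ^ m * \<sigma> ^ m * (- (x / \<sigma>)) ^ d = (- \<sigma>) ^ k * x ^ d"
    proof -
      have "(-1) ^ m * \<sigma> ^ m * (- (x / \<sigma>)) ^ d = (- \<sigma>) ^ m * (- (x / \<sigma>)) ^ d"
        by (simp add: power_mult_distrib[symmetric])
      also have "\<dots> = (- \<sigma>) ^ k * ((- \<sigma>) * (- (x / \<sigma>))) ^ d"
        unfolding power_mult_distrib by (simp add: m power_add)
      finally show ?thesis using assms by simp
    qed
    ultimately show "(-1) ^ m * fact m * \<sigma> ^ m *
         (of_nat ((m + l) choose k) * (- (x / \<sigma>)) ^ (m - k) / fact (m - k))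
      = fact k * of_nat ((m + l) choose k) * of_nat (m choose k) * (- \<sigma>) ^ k * x ^ (m - k)"
      by (simp add: m field_simps)
  qed
  finally show ?thesis .
qed

lemma of_real_scaled_laguerre:
  "of_real (scaled_laguerre m l x \<sigma>) = scaled_laguerre m l (of_real x) (of_real \<sigma> :: complex)"
  by (simp add: scaled_laguerre_def laguerre_explicit)

section \<open>Complex Hermite polynomials and their translates\<close>

definition complex_hermite :: "nat \<Rightarrow> nat \<Rightarrow> 'a::field_char_0 \<Rightarrow> 'a \<Rightarrow> 'a \<Rightarrow> 'a" where
  "complex_hermite p q \<sigma> a b =
     (\<Sum>k\<le>min p q. fact k * of_nat (p choose k) * of_nat (q choose k) * (- \<sigma>) ^ k
        * a ^ (p - k) * b ^ (q - k))"

lemma complex_hermite_commute: "complex_hermite p q \<sigma> a b = complex_hermite q p \<sigma> b a"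
  unfolding complex_hermite_def min.commute[of p q] by (intro sum.cong) (simp_all add: mult_ac)

lemma complex_hermite_extend_range:
  assumes "min p q \<le> n"
  shows "complex_hermite p q \<sigma> a b =
     (\<Sum>k\<le>n. fact k * of_nat (p choose k) * of_nat (q choose k) * (- \<sigma>) ^ k
        * a ^ (p - k) * b ^ (q - k))"
  unfolding complex_hermite_def
  using assms by (intro sum.mono_neutral_left) (auto simp: not_le min_less_iff_disj)

text \<open>
  Up to the factor \<open>k!\<close> this is the Taylor expansion at \<open>a\<close> of the \<open>k\<close>-th derivative of the
  \<open>p\<close>-th power. Every \<open>i \<le> p\<close> is admitted, since the terms with \<open>i > p - k\<close> vanish.
\<close>
lemma choose_times_power_add:
  fixes z a :: "'a::comm_semiring_1"
  shows "of_nat (p choose k) * (z + a) ^ (p - k) =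
    (\<Sum>i\<le>p. of_nat (p choose i) * z ^ i * (of_nat ((p - i) choose k) * a ^ (p - i - k)))"
proof (cases "k \<le> p")
  case True
  have "of_nat (p choose k) * (z + a) ^ (p - k) =
      (\<Sum>i\<le>p - k. of_nat (p choose k) * (of_nat ((p - k) choose i) * z ^ i * a ^ (p - k - i)))"
    by (simp add: binomial_ring sum_distrib_left)
  also have "\<dots> = (\<Sum>i\<le>p. of_nat (p choose i) * z ^ i
      * (of_nat ((p - i) choose k) * a ^ (p - i - k)))"
  proof (intro sum.mono_neutral_cong_left ballI)
    fix i assume "i \<in> {..p - k}"
    then have i: "i + k \<le> p" using True by simp
    \<comment> \<open>Both sides count pairs of disjoint subsets of sizes \<open>k\<close> and \<open>i\<close>.\<close>
    have "(p choose k) * ((p - k) choose i) = (p choose i) * ((p - i) choose k)"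
      using choose_mult[of k "k + i" p] choose_mult[of i "k + i" p] i
            binomial_symmetric[of k "k + i"]
      by (simp add: add.commute)
    then have "of_nat (p choose k) * of_nat ((p - k) choose i) =
        (of_nat (p choose i) * of_nat ((p - i) choose k) :: 'a)"
      by (metis of_nat_mult)
    then have "of_nat (p choose k) * of_nat ((p - k) choose i) * (z ^ i * a ^ (p - k - i)) =
        of_nat (p choose i) * of_nat ((p - i) choose k) * (z ^ i * a ^ (p - i - k))"
      by (simp only: diff_commute[of p k i])
    then show "of_nat (p choose k) * (of_nat ((p - k) choose i) * z ^ i * a ^ (p - k - i)) =
        of_nat (p choose i) * z ^ i * (of_nat ((p - i) choose k) * a ^ (p - i - k))"
      by (simp only: mult_ac)
  qed (use True in \<open>auto simp: not_le binomial_eq_0\<close>)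
  finally show ?thesis .
next
  case False
  then show ?thesis by (simp add: not_le binomial_eq_0)
qed

text \<open>
  In operator terms this holds because \<open>exp (-\<sigma> \<partial>\<^sub>a \<partial>\<^sub>b)\<close> commutes with translations. In
  coefficients, each summand of the left-hand side is, up to a constant, a product of two
  derivatives of powers, and each factor is expanded separately.
\<close>
lemma complex_hermite_translate:
  "complex_hermite p q \<sigma> (z + a) (w + b) =
    (\<Sum>i\<le>p. \<Sum>j\<le>q. of_nat (p choose i) * of_nat (q choose j)
       * complex_hermite (p - i) (q - j) \<sigma> a b * z ^ i * w ^ j)"
proof -
  have "complex_hermite p q \<sigma> (z + a) (w + b) =
      (\<Sum>k\<le>p. fact k * (- \<sigma>) ^ k * ((of_nat (p choose k) * (z + a) ^ (p - k))
         * (of_nat (q choose k) * (w + b) ^ (q - k))))"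
    by (subst complex_hermite_extend_range[of _ _ p]) (simp_all add: mult_ac)
  also have "\<dots> = (\<Sum>k\<le>p. \<Sum>i\<le>p. \<Sum>j\<le>q. fact k * (- \<sigma>) ^ k *
      ((of_nat (p choose i) * z ^ i * (of_nat ((p - i) choose k) * a ^ (p - i - k))) *
       (of_nat (q choose j) * w ^ j * (of_nat ((q - j) choose k) * b ^ (q - j - k)))))"
    unfolding choose_times_power_add sum_product unfolding sum_distrib_left ..
  also have "\<dots> = (\<Sum>i\<le>p. \<Sum>j\<le>q. \<Sum>k\<le>p. fact k * (- \<sigma>) ^ k *
      ((of_nat (p choose i) * z ^ i * (of_nat ((p - i) choose k) * a ^ (p - i - k))) *
       (of_nat (q choose j) * w ^ j * (of_nat ((q - j) choose k) * b ^ (q - j - k)))))"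
    by (subst sum.swap) (intro sum.cong refl sum.swap)
  also have "\<dots> = (\<Sum>i\<le>p. \<Sum>j\<le>q. of_nat (p choose i) * of_nat (q choose j)
       * complex_hermite (p - i) (q - j) \<sigma> a b * z ^ i * w ^ j)"
    by (intro sum.cong refl, subst complex_hermite_extend_range[of _ _ p])
       (auto simp: sum_distrib_left sum_distrib_right mult_ac intro!: sum.cong)
  finally show ?thesis .
qed

lemma scaled_laguerre_eq_complex_hermite:
  fixes a b \<sigma> :: "'a::field_char_0"
  assumes "\<sigma> \<noteq> 0"
  shows "(-1) ^ q * fact q * scaled_laguerre q l (a * b) \<sigma> * a ^ l =
    complex_hermite (q + l) q \<sigma> a b"
proof -
  have "a ^ (q + l - k) = a ^ (q - k) * a ^ l" if "k \<le> q" for k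
    using that by (simp flip: power_add)
  then show ?thesis
    unfolding scaled_laguerre_explicit[OF assms] complex_hermite_def
    unfolding sum_distrib_right by (intro sum.cong) (auto simp: power_mult_distrib mult_ac)
qed

section \<open>The addition formula\<close>

text \<open>The two forms of \<open>P\<close> are the cases \<open>p \<ge> q\<close> and \<open>p < q\<close> of \<open>H\<^sub>p\<^sub>q\<close>.\<close>
lemma laguerre_P_eq_complex_hermite:
  assumes "\<sigma> > 0" and "i \<le> m + l" and "j \<le> m"
  shows "laguerre_P m l \<sigma> i j y =
    complex_hermite (m + l - i) (m - j) (of_real \<sigma>) y (cnj y)"
proof -
  have s: "(of_real \<sigma> :: complex) \<noteq> 0" using assms(1) by simp
  show ?thesis
  proof (cases "i \<le> l + j")
    case True
    then have "(m - j) + (l + j - i) = m + l - i" using assms by simp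
    then show ?thesis
      using True scaled_laguerre_eq_complex_hermite[OF s, of "m - j" "l + j - i" y "cnj y"]
      unfolding laguerre_P_def of_real_scaled_laguerre complex_norm_square by (simp only: if_True)
  next
    case False
    then have "(m + l - i) + (i - j - l) = m - j" using assms by simp
    then show ?thesis
      using False scaled_laguerre_eq_complex_hermite[OF s, of "m + l - i" "i - j - l" "cnj y" y]
      unfolding laguerre_P_def of_real_scaled_laguerre complex_norm_square
        complex_hermite_commute[of "m + l - i"] mult.commute[of "cnj y" y]
      by (simp only: if_False)
  qed
qed

theorem lemma3p1:
  fixes m l :: nat and \<sigma> :: real and x y :: complex
  assumes "m \<ge> 1" and "\<sigma> > 0"
  shows "(-1) ^ m * fact m * of_real (scaled_laguerre m l ((cmod (x + y))\<^sup>2) \<sigma>) * (x + y) ^ l =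
    (\<Sum>i = 0..m + l. \<Sum>j = 0..m.
       of_nat ((m + l) choose i) * of_nat (m choose j) * laguerre_P m l \<sigma> i j y * x ^ i * cnj x ^ j)"
proof -
  have s: "(of_real \<sigma> :: complex) \<noteq> 0" using assms(2) by simp
  have "(-1) ^ m * fact m * of_real (scaled_laguerre m l ((cmod (x + y))\<^sup>2) \<sigma>) * (x + y) ^ l =
      complex_hermite (m + l) m (of_real \<sigma>) (x + y) (cnj x + cnj y)"
    unfolding of_real_scaled_laguerre complex_norm_square
      scaled_laguerre_eq_complex_hermite[OF s] by simp
  also have "\<dots> = (\<Sum>i\<le>m + l. \<Sum>j\<le>m. of_nat ((m + l) choose i) * of_nat (m choose j)
      * laguerre_P m l \<sigma> i j y * x ^ i * cnj x ^ j)"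
    unfolding complex_hermite_translate
    by (intro sum.cong refl) (simp add: laguerre_P_eq_complex_hermite[OF assms(2)])
  finally show ?thesis by (simp add: atMost_atLeast0)
qed

end
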